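(* Let $T_h$ be the complete binary tree of height $h$, and let $1\le g<h$. Let $A$ be the top subtree consisting of the nodes on levels $0,\dots,g-1$. Let $L_A$ be the set of leaves of $A$, i.e. the nodes on level $g-1$. The bottom subtrees are the $2^g$ subtrees rooted at the nodes on level $g$. Each bottom subtree consists of its root and all descendants, is a complete binary tree of height $h-g$, and has as its parent leaf the parent of its root, which lies in $L_A$. Consider layouts $\pi$ (bijections from the nodes to $\{1,\dots,2^h-1\}$) in which $A$ occupies a contiguous interval and each bottom subtree occupies a contiguous interval. Fix the following data: - the positions $\pi(x)$ of all nodes $x$ of $A$; - a collection of $2^g$ pairwise disjoint intervals (slots), each disjoint from the interval of $A$ and each lying to its left or to its right, together with, for each slot, a layout of the complete binary tree of height $h-g$ into that slot (a slot receiving a bottom subtree lays it out by this fixed pattern via the canonical isomorphism); - a partition of the bottom subtrees into a left group and a right group, whose sizes equal the numbers of slots to the left and to the right of $A$, respectively. Among all bijections assigning the bottom subtrees to slots so that left-group subtrees go to left slots and right-group subtrees go to right slots, consider the product $$\prod_{B}\,\bigl|\pi(x_B)-\pi(\mathrm{root}(B))\bigr|$$ of the lengths of the $2^g$ edges joining each bottom subtree $B$ to its parent leaf $x_B$. This product is minimized by any assignment that places the bottom subtrees in reverse order of their parent leaves. That is, for any two bottom subtrees $X,Y$ on the same side of $A$ with distinct parent leaves $x,y$ satisfying $\pi(x)<\pi(y)$, the subtree $Y$ is placed to the left of $X$. Bottom subtrees sharing a parent leaf may appear in either order.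
   Context: The complete binary tree $T_h$ of height $h$ has levels $0,\dots,h-1$ with the root on level $0$. The length of an edge $uv$ in a layout $\pi$ is $|\pi(u)-\pi(v)|$. All edges between the top subtree and the bottom subtrees join levels $g-1$ and $g$, and hence carry equal weight in the weighted edge product. *)

theory Defs
  imports Complex_Main "HOL-Library.Sublist" "HOL-Library.Disjoint_Sets"
begin

text \<open>A node of a complete binary tree is the list of left/right choices on the path leading to it
  from the root; the root is \<^term>\<open>[]\<close>, and the level of a node is the length of the list.\<close>

type_synonym node = "bool list"

definition cbt :: "nat \<Rightarrow> node set" where
  "cbt h = {v. length v < h}"

definition parent :: "node \<Rightarrow> node" where
  "parent v = butlast v"

definition level :: "nat \<Rightarrow> nat \<Rightarrow> node set" where
  "level h i = {v \<in> cbt h. length v = i}"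

definition top_subtree :: "nat \<Rightarrow> nat \<Rightarrow> node set" where
  "top_subtree h g = (\<Union>i<g. level h i)"

definition subtree :: "nat \<Rightarrow> node \<Rightarrow> node set" where
  "subtree h r = {v \<in> cbt h. prefix r v}"

definition is_layout :: "nat \<Rightarrow> (node \<Rightarrow> int) \<Rightarrow> bool" where
  "is_layout h \<pi> \<longleftrightarrow> bij_betw \<pi> (cbt h) {1..2 ^ h - 1}"

definition edge_length :: "(node \<Rightarrow> int) \<Rightarrow> node \<Rightarrow> node \<Rightarrow> int" where
  "edge_length \<pi> u v = \<bar>\<pi> u - \<pi> v\<bar>"

definition contiguous :: "int set \<Rightarrow> bool" where
  "contiguous I \<longleftrightarrow> (\<exists>a b. I = {a..b})"

definition left_of :: "int set \<Rightarrow> int set \<Rightarrow> bool" where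
  "left_of I J \<longleftrightarrow> (\<forall>p\<in>I. \<forall>q\<in>J. p < q)"

text \<open>The fixed data: \<open>pA\<close> gives the positions of the nodes of the top subtree, and \<open>pat I\<close> is the
  fixed layout of the complete binary tree of height \<open>h - g\<close> into the slot \<open>I\<close>.\<close>

definition fixed_positions :: "nat \<Rightarrow> nat \<Rightarrow> (node \<Rightarrow> int) \<Rightarrow> int set set \<Rightarrow>
    (int set \<Rightarrow> node \<Rightarrow> int) \<Rightarrow> bool" where
  "fixed_positions h g pA slots pat \<longleftrightarrow>
     inj_on pA (top_subtree h g) \<and>
     contiguous (pA ` top_subtree h g) \<and>
     pA ` top_subtree h g \<subseteq> {1..2 ^ h - 1} \<and>
     card slots = 2 ^ g \<and>
     disjoint slots \<and>
     (\<forall>I\<in>slots. contiguous I \<and> I \<subseteq> {1..2 ^ h - 1} \<and>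
        I \<inter> pA ` top_subtree h g = {} \<and>
        (left_of I (pA ` top_subtree h g) \<or> left_of (pA ` top_subtree h g) I) \<and>
        bij_betw (pat I) (cbt (h - g)) I)"

text \<open>Bottom subtrees are represented by their roots, the nodes on level \<open>g\<close>.\<close>

definition left_right_groups :: "nat \<Rightarrow> nat \<Rightarrow> (node \<Rightarrow> int) \<Rightarrow> int set set \<Rightarrow>
    node set \<Rightarrow> node set \<Rightarrow> bool" where
  "left_right_groups h g pA slots Lg Rg \<longleftrightarrow>
     Lg \<union> Rg = level h g \<and> Lg \<inter> Rg = {} \<and>
     card Lg = card {I \<in> slots. left_of I (pA ` top_subtree h g)} \<and>
     card Rg = card {I \<in> slots. left_of (pA ` top_subtree h g) I}"

definition admissible :: "nat \<Rightarrow> nat \<Rightarrow> (node \<Rightarrow> int) \<Rightarrow> int set set \<Rightarrow>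
    node set \<Rightarrow> node set \<Rightarrow> (node \<Rightarrow> int set) \<Rightarrow> bool" where
  "admissible h g pA slots Lg Rg \<beta> \<longleftrightarrow>
     bij_betw \<beta> (level h g) slots \<and>
     (\<forall>r\<in>Lg. left_of (\<beta> r) (pA ` top_subtree h g)) \<and>
     (\<forall>r\<in>Rg. left_of (pA ` top_subtree h g) (\<beta> r))"

text \<open>The canonical isomorphism from \<open>cbt (h - g)\<close> to the bottom subtree with root \<open>r\<close> is
  \<open>w \<mapsto> r @ w\<close>; its inverse is \<open>drop g\<close>, and \<open>take g v\<close> is the root of the bottom subtree
  containing \<open>v\<close>.\<close>

definition induced_layout :: "nat \<Rightarrow> (node \<Rightarrow> int) \<Rightarrow> (int set \<Rightarrow> node \<Rightarrow> int) \<Rightarrow>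
    (node \<Rightarrow> int set) \<Rightarrow> node \<Rightarrow> int" where
  "induced_layout g pA pat \<beta> v =
     (if length v < g then pA v else pat (\<beta> (take g v)) (drop g v))"

definition connecting_product :: "nat \<Rightarrow> nat \<Rightarrow> (node \<Rightarrow> int) \<Rightarrow> int" where
  "connecting_product h g \<pi> = (\<Prod>r\<in>level h g. edge_length \<pi> (parent r) r)"

definition reverse_ordered :: "nat \<Rightarrow> node set \<Rightarrow> node set \<Rightarrow> (node \<Rightarrow> int) \<Rightarrow> bool" where
  "reverse_ordered h Lg Rg \<pi> \<longleftrightarrow>
     (\<forall>X Y. (X \<in> Lg \<and> Y \<in> Lg \<or> X \<in> Rg \<and> Y \<in> Rg) \<and>
        parent X \<noteq> parent Y \<and> \<pi> (parent X) < \<pi> (parent Y) \<longrightarrow>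
        left_of (\<pi> ` subtree h Y) (\<pi> ` subtree h X))"

lemma card_cbt: "finite (cbt h)" "card (cbt h) = 2 ^ h - 1"
proof -
  have *: "finite (cbt h) \<and> card (cbt h) = 2 ^ h - 1"
  proof (induction h)
    case 0
    show ?case by (simp add: cbt_def)
  next
    case (Suc h)
    have eq: "cbt (Suc h) = cbt h \<union> {v. length v = h}"
      by (auto simp: cbt_def)
    have f: "finite {v :: node. length v = h}" and c: "card {v :: node. length v = h} = 2 ^ h"
      using finite_lists_length_eq[of "UNIV :: bool set" h]
        card_lists_length_eq[of "UNIV :: bool set" h] by simp_all
    have "cbt h \<inter> {v. length v = h} = {}" by (auto simp: cbt_def)
    then show ?case using Suc f c by (simp add: eq card_Un_disjoint)
  qed
  then show "finite (cbt h)" "card (cbt h) = 2 ^ h - 1" by auto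
qed

lemma image_induced_layout_top:
  "induced_layout g pA pat \<beta> ` top_subtree h g = pA ` top_subtree h g"
  by (rule image_cong) (auto simp: top_subtree_def level_def induced_layout_def)

lemma image_induced_layout_bottom:
  assumes "fixed_positions h g pA slots pat" "admissible h g pA slots Lg Rg \<beta>"
    and r: "r \<in> level h g"
  shows "induced_layout g pA pat \<beta> ` subtree h r = \<beta> r"
proof -
  have len: "length r = g" "g < h" using r by (auto simp: level_def cbt_def)
  have "\<beta> r \<in> slots" using assms by (auto simp: admissible_def bij_betw_def)
  then have b: "pat (\<beta> r) ` cbt (h - g) = \<beta> r"
    using assms(1) by (auto simp: fixed_positions_def bij_betw_def)
  have s: "subtree h r = (\<lambda>w. r @ w) ` cbt (h - g)"
    using len by (auto simp: subtree_def cbt_def prefix_def)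
  show ?thesis unfolding s image_image using len b by (simp add: induced_layout_def)
qed

lemma is_layout_induced_layout:
  assumes gh: "g < h"
    and fp: "fixed_positions h g pA slots pat" and ad: "admissible h g pA slots Lg Rg \<beta>"
  shows "is_layout h (induced_layout g pA pat \<beta>)"
proof -
  let ?\<pi> = "induced_layout g pA pat \<beta>"
  have bij: "bij_betw \<beta> (level h g) slots" using ad by (simp add: admissible_def)
  have tk: "take g v \<in> level h g" "drop g v \<in> cbt (h - g)" if "v \<in> cbt h" "\<not> length v < g" for v
    using that gh by (auto simp: level_def cbt_def)
  have sl: "\<beta> (take g v) \<in> slots" if "v \<in> cbt h" "\<not> length v < g" for v
    using bij tk[OF that] by (auto simp: bij_betw_def)
  have top: "v \<in> top_subtree h g" if "v \<in> cbt h" "length v < g" for v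
    using that by (auto simp: top_subtree_def level_def)
  have slot: "I \<inter> pA ` top_subtree h g = {}" "I \<subseteq> {1..2 ^ h - 1}"
    "bij_betw (pat I) (cbt (h - g)) I" if "I \<in> slots" for I
    using fp that unfolding fixed_positions_def by blast+
  have mem: "?\<pi> v \<in> \<beta> (take g v)" if "v \<in> cbt h" "\<not> length v < g" for v
    using slot(3)[OF sl[OF that]] tk(2)[OF that] that(2)
    by (auto simp: induced_layout_def bij_betw_def)
  have memA: "?\<pi> v \<in> pA ` top_subtree h g" if "v \<in> cbt h" "length v < g" for v
    using top[OF that] that(2) by (auto simp: induced_layout_def)
  have sub: "?\<pi> ` cbt h \<subseteq> {1..2 ^ h - 1}"
  proof
    fix p assume "p \<in> ?\<pi> ` cbt h"
    then obtain v where v: "v \<in> cbt h" "p = ?\<pi> v" by blast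
    show "p \<in> {1..2 ^ h - 1}"
    proof (cases "length v < g")
      case True
      then show ?thesis using memA[OF v(1)] v(2) fp unfolding fixed_positions_def by blast
    next
      case False
      then show ?thesis using mem[OF v(1)] slot(2)[OF sl[OF v(1)]] v(2) by blast
    qed
  qed
  have inj: "inj_on ?\<pi> (cbt h)"
  proof (rule inj_onI)
    fix u v assume u: "u \<in> cbt h" and v: "v \<in> cbt h" and eq: "?\<pi> u = ?\<pi> v"
    consider "length u < g" "length v < g" | "length u < g" "\<not> length v < g"
      | "\<not> length u < g" "length v < g" | "\<not> length u < g" "\<not> length v < g" by blast
    then show "u = v"
    proof cases
      case 1
      have "pA u = pA v" using eq 1 by (simp add: induced_layout_def)
      moreover have "inj_on pA (top_subtree h g)" using fp by (simp add: fixed_positions_def)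
      ultimately show ?thesis using top[OF u 1(1)] top[OF v 1(2)] by (auto dest: inj_onD)
    next
      case 2
      then show ?thesis using memA[OF u] mem[OF v] slot(1)[OF sl[OF v]] eq by auto
    next
      case 3
      then show ?thesis using memA[OF v] mem[OF u] slot(1)[OF sl[OF u]] eq by auto
    next
      case 4
      have "\<beta> (take g u) = \<beta> (take g v)"
      proof (rule ccontr)
        assume "\<beta> (take g u) \<noteq> \<beta> (take g v)"
        moreover have "disjoint slots" using fp by (simp add: fixed_positions_def)
        ultimately have "\<beta> (take g u) \<inter> \<beta> (take g v) = {}"
          using sl[OF u 4(1)] sl[OF v 4(2)] by (auto dest: disjointD)
        then show False using mem[OF u 4(1)] mem[OF v 4(2)] eq by auto
      qed
      then have t: "take g u = take g v"
        using bij tk(1)[OF u 4(1)] tk(1)[OF v 4(2)] by (auto simp: bij_betw_def dest: inj_onD)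
      have "pat (\<beta> (take g v)) (drop g u) = pat (\<beta> (take g v)) (drop g v)"
        using eq 4 t by (simp add: induced_layout_def)
      then have "drop g u = drop g v"
        using slot(3)[OF sl[OF v 4(2)]] tk(2)[OF u 4(1)] tk(2)[OF v 4(2)]
        by (auto simp: bij_betw_def dest: inj_onD)
      then show ?thesis using t by (metis append_take_drop_id)
    qed
  qed
  have "card (?\<pi> ` cbt h) = 2 ^ h - 1"
    using card_image[OF inj] card_cbt(2) by simp
  moreover have "card {1..2 ^ h - 1 :: int} = 2 ^ h - 1"
    by (simp add: nat_diff_distrib nat_power_eq)
  ultimately have "?\<pi> ` cbt h = {1..2 ^ h - 1}"
    using sub by (intro card_subset_eq) auto
  then show ?thesis using inj by (simp add: is_layout_def bij_betw_def)
qed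

end

theory Submission
  imports Defs
begin

text \<open>On each side of the top subtree the edge lengths are differences \<open>a i - f t\<close> between a leaf
  position and a root position, with a fixed sign. If \<open>a k \<le> a i\<close> and \<open>s \<le> t\<close>, then
  \<open>(a i - t) * (a k - s) - (a i - s) * (a k - t) = (a i - a k) * (t - s) \<ge> 0\<close>, so matching the
  largest \<open>a\<close> with the smallest root position never increases the product; remove that pair and
  induct.\<close>

text \<open>This is the re-matching step of the exchange: \<open>i\<close> leaves, \<open>k\<close>
  gives up its partner and inherits that of \<open>i\<close>. For \<open>k = i\<close> the update is
  trivial, and the rule deletes a single matched pair.\<close>

lemma bij_betw_exchange_remove:
  assumes "bij_betw \<gamma> S T" and "i \<in> S" and "k \<in> S"
  shows "bij_betw (\<gamma>(k := \<gamma> i)) (S - {i}) (T - {\<gamma> k})"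
  using assms unfolding bij_betw_def inj_on_def by (auto simp: image_iff)

text \<open>Arbitrary index types and signs let one statement serve both sides of the top subtree.
  Order is prescribed only where \<open>a\<close> differs strictly, so sibling subtrees, which share
  a parent leaf, may come in either order.\<close>

lemma prod_diff_le_of_antitone_bij:
  fixes a :: "'i \<Rightarrow> 'a :: linordered_idom" and f :: "'j \<Rightarrow> 'a"
  assumes "finite S" and "bij_betw \<beta> S T" and "bij_betw \<gamma> S T"
    and "\<And>i t. i \<in> S \<Longrightarrow> t \<in> T \<Longrightarrow> f t \<le> a i"
    and "\<And>i j. i \<in> S \<Longrightarrow> j \<in> S \<Longrightarrow> a i < a j \<Longrightarrow> f (\<beta> j) \<le> f (\<beta> i)"
  shows "(\<Prod>i\<in>S. a i - f (\<beta> i)) \<le> (\<Prod>i\<in>S. a i - f (\<gamma> i))"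
  using assms
\<comment> \<open>\<open>\<beta>\<close> stays fixed because it is merely restricted, whereas each
  exchange alters the competitor \<open>\<gamma>\<close>.\<close>
proof (induction "card S" arbitrary: S T \<gamma>)
  case 0
  then show ?case by simp
next
  case (Suc n)
  note fin = \<open>finite S\<close> and \<beta> = \<open>bij_betw \<beta> S T\<close> and \<gamma> = \<open>bij_betw \<gamma> S T\<close>
    and le = Suc.prems(4) and anti = Suc.prems(5)
  have "S \<noteq> {}" using Suc.hyps(2) by auto
  \<comment> \<open>Antitonicity says nothing about ties in \<open>a\<close>. Among all maximizers
    of \<open>a\<close>, the one with the smallest \<open>f (\<beta> i)\<close> is chosen; this
    makes \<open>f (\<beta> i)\<close> minimal over all of \<open>S\<close>.\<close>
  define M where "M = {i \<in> S. a i = Max (a ` S)}"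
  have "Max (a ` S) \<in> a ` S" using fin \<open>S \<noteq> {}\<close> by simp
  then have "M \<noteq> {}" "finite M" using fin by (auto simp: M_def)
  then have "Min ((\<lambda>i. f (\<beta> i)) ` M) \<in> (\<lambda>i. f (\<beta> i)) ` M" by simp
  then obtain i where "i \<in> M" and fi: "f (\<beta> i) = Min ((\<lambda>i. f (\<beta> i)) ` M)" by auto
  have iS: "i \<in> S" using \<open>i \<in> M\<close> by (simp add: M_def)
  have amax: "a j \<le> a i" if "j \<in> S" for j using \<open>i \<in> M\<close> fin that by (simp add: M_def)
  have fmin: "f (\<beta> i) \<le> f (\<beta> j)" if "j \<in> S" for j
  proof (cases "j \<in> M")
    case True
    then show ?thesis using fi \<open>finite M\<close> by simp
  next
    case False
    then have "a j < a i" using that amax[OF that] \<open>i \<in> M\<close> by (auto simp: M_def)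
    then show ?thesis using anti that iS by blast
  qed
  have "\<beta> i \<in> T" using \<beta> iS by (auto simp: bij_betw_def)
  \<comment> \<open>\<open>k\<close> is the index to which the competitor gives the optimal partner
    of \<open>i\<close>.\<close>
  then obtain k where k: "k \<in> S" "\<gamma> k = \<beta> i" using \<gamma> by (auto simp: bij_betw_def)
  have \<gamma>T: "\<gamma> j \<in> T" if "j \<in> S" for j using \<gamma> that by (auto simp: bij_betw_def)
  have fminT: "f (\<beta> i) \<le> f t" if "t \<in> T" for t using \<beta> that fmin by (auto simp: bij_betw_def)
  let ?\<gamma>' = "\<gamma>(k := \<gamma> i)"
  have IH: "(\<Prod>j\<in>S - {i}. a j - f (\<beta> j)) \<le> (\<Prod>j\<in>S - {i}. a j - f (?\<gamma>' j))"
  proof (rule Suc.hyps(1))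
    show "n = card (S - {i})" using Suc.hyps(2) iS fin by simp
    show "bij_betw \<beta> (S - {i}) (T - {\<beta> i})"
      using bij_betw_exchange_remove[OF \<beta> iS iS] by simp
    show "bij_betw ?\<gamma>' (S - {i}) (T - {\<beta> i})"
      using bij_betw_exchange_remove[OF \<gamma> iS k(1)] k(2) by simp
  qed (use fin le anti in auto)
  have "(\<Prod>j\<in>S. a j - f (\<beta> j)) = (a i - f (\<beta> i)) * (\<Prod>j\<in>S - {i}. a j - f (\<beta> j))"
    by (rule prod.remove[OF fin iS])
  also have "\<dots> \<le> (a i - f (\<beta> i)) * (\<Prod>j\<in>S - {i}. a j - f (?\<gamma>' j))"
    by (rule mult_left_mono[OF IH]) (use le[OF iS \<open>\<beta> i \<in> T\<close>] in simp)
  also have "\<dots> \<le> (\<Prod>j\<in>S. a j - f (\<gamma> j))"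
  proof (cases "k = i")
    case True
    then show ?thesis using k(2) by (simp add: prod.remove[OF fin iS])
  next
    case False
    let ?P = "\<Prod>j\<in>S - {i} - {k}. a j - f (\<gamma> j)"
    have kSi: "k \<in> S - {i}" using False k(1) by simp
    have "(\<Prod>j\<in>S - {i}. a j - f (?\<gamma>' j)) = (a k - f (\<gamma> i)) * ?P"
      using fin by (subst prod.remove[OF _ kSi]) (auto intro!: prod.cong)
    moreover have "(\<Prod>j\<in>S. a j - f (\<gamma> j)) = (a i - f (\<gamma> i)) * ((a k - f (\<beta> i)) * ?P)"
      using fin k(2) by (simp add: prod.remove[OF fin iS] prod.remove[OF _ kSi])
    moreover have "0 \<le> ?P" by (intro prod_nonneg) (use le \<gamma>T in simp)
    moreover have "(a i - f (\<beta> i)) * (a k - f (\<gamma> i)) \<le> (a i - f (\<gamma> i)) * (a k - f (\<beta> i))"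
    proof -
      \<comment> \<open>Both factors are nonnegative since \<open>a i\<close> is maximal and
        \<open>f (\<beta> i)\<close> minimal; expanding gives the two-pair exchange
        inequality.\<close>
      have "0 \<le> (a i - a k) * (f (\<gamma> i) - f (\<beta> i))"
        using amax[OF k(1)] fminT[OF \<gamma>T[OF iS]] by simp
      then show ?thesis by (simp add: algebra_simps)
    qed
    ultimately show ?thesis by (simp add: mult.assoc[symmetric] mult_right_mono)
  qed
  finally show ?case .
qed

theorem theorem2:
  fixes h g :: nat
    and pA :: "node \<Rightarrow> int"
    and slots :: "int set set"
    and pat :: "int set \<Rightarrow> node \<Rightarrow> int"
    and Lg Rg :: "node set"
    and \<beta> :: "node \<Rightarrow> int set"
  assumes "1 \<le> g" and "g < h"
    and "fixed_positions h g pA slots pat"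
    and "left_right_groups h g pA slots Lg Rg"
    and "admissible h g pA slots Lg Rg \<beta>"
    and "reverse_ordered h Lg Rg (induced_layout g pA pat \<beta>)"
  shows "is_arg_min (\<lambda>\<gamma>. connecting_product h g (induced_layout g pA pat \<gamma>))
           (admissible h g pA slots Lg Rg) \<beta>"
proof -
  let ?A = "pA ` top_subtree h g"
  let ?\<pi> = "induced_layout g pA pat"
  \<comment> \<open>The root of whichever bottom subtree receives slot \<open>I\<close> lies here,
    so an assignment affects the product only by permuting these numbers.\<close>
  let ?f = "\<lambda>I. pat I []"
  let ?E = "\<lambda>\<gamma> r. edge_length (?\<pi> \<gamma>) (parent r) r"
  define SL SR where "SL = {I \<in> slots. left_of I ?A}" and "SR = {I \<in> slots. left_of ?A I}"
  note g1 = assms(1) and gh = assms(2) and fp = assms(3) and lr = assms(4) and ad = assms(5)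
    and ro = assms(6)
  have union: "Lg \<union> Rg = level h g" "Lg \<inter> Rg = {}" and cards: "card Lg = card SL" "card Rg = card SR"
    using lr by (simp_all add: left_right_groups_def SL_def SR_def)
  have "finite (level h g)" using card_cbt(1)[of h] by (simp add: level_def)
  then have fin: "finite Lg" "finite Rg" using union(1) by (metis finite_Un)+
  have "card slots = 2 ^ g" using fp by (simp add: fixed_positions_def)
  \<comment> \<open>An infinite set has \<open>card\<close> equal to 0, so a positive cardinality
    forces finiteness.\<close>
  then have finS: "finite slots" by (intro card_ge_0_finite) simp
  have len: "length r = g" if "r \<in> level h g" for r using that by (simp add: level_def)
  have \<pi>root: "?\<pi> \<gamma> r = ?f (\<gamma> r)" if "r \<in> level h g" for \<gamma> r
    using len[OF that] by (simp add: induced_layout_def)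
  \<comment> \<open>Here \<open>1 \<le> g\<close> matters: it puts the parent on level
    \<open>g - 1\<close>, inside the top subtree, while \<open>butlast []\<close> would be the root
    itself.\<close>
  have \<pi>parent: "?\<pi> \<gamma> (parent r) = pA (parent r)" if "r \<in> level h g" for \<gamma> r
    using len[OF that] g1 by (simp add: induced_layout_def parent_def)
  have parA: "pA (parent r) \<in> ?A" if "r \<in> level h g" for r
    using len[OF that] g1 gh by (auto simp: top_subtree_def level_def cbt_def parent_def)
  have root: "?f I \<in> I" if "I \<in> slots" for I
  proof -
    have "bij_betw (pat I) (cbt (h - g)) I" using fp that unfolding fixed_positions_def by blast
    moreover have "[] \<in> cbt (h - g)" using gh by (simp add: cbt_def)
    ultimately show ?thesis by (auto simp: bij_betw_def)
  qed
  \<comment> \<open>Admissibility gives injections into the slots of each side; equal finite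
    cardinalities make them onto, so the two sides can be optimized separately.\<close>
  have bijL: "bij_betw \<gamma> Lg SL" and bijR: "bij_betw \<gamma> Rg SR"
    if "admissible h g pA slots Lg Rg \<gamma>" for \<gamma>
  proof -
    have b: "inj_on \<gamma> (level h g)" "\<gamma> ` level h g = slots"
      using that by (auto simp: admissible_def bij_betw_def)
    have inj: "inj_on \<gamma> Lg" "inj_on \<gamma> Rg"
      using b(1) union(1) by (auto intro: inj_on_subset)
    have "\<gamma> ` Lg \<subseteq> SL" "\<gamma> ` Rg \<subseteq> SR"
      using that b(2) union(1) by (auto simp: admissible_def SL_def SR_def)
    moreover have "finite SL" "finite SR" using finS by (simp_all add: SL_def SR_def)
    ultimately have "\<gamma> ` Lg = SL" "\<gamma> ` Rg = SR"
      using cards card_image[OF inj(1)] card_image[OF inj(2)] by (simp_all add: card_subset_eq)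
    then show "bij_betw \<gamma> Lg SL" "bij_betw \<gamma> Rg SR" using inj by (auto simp: bij_betw_def)
  qed
  have ltL: "?f I < pA (parent r)" if "r \<in> level h g" "I \<in> SL" for r I
    using parA[OF that(1)] root[of I] that(2) unfolding SL_def left_of_def by blast
  have ltR: "pA (parent r) < ?f I" if "r \<in> level h g" "I \<in> SR" for r I
    using parA[OF that(1)] root[of I] that(2) unfolding SR_def left_of_def by blast
  \<comment> \<open>The reverse order of whole subtrees is specialized to their roots; the strict
    inequality already forces distinct parents.\<close>
  have anti: "?f (\<beta> Y) < ?f (\<beta> X)"
    if XY: "X \<in> Lg \<and> Y \<in> Lg \<or> X \<in> Rg \<and> Y \<in> Rg" and lt: "pA (parent X) < pA (parent Y)" for X Y
  proof -
    have lev: "X \<in> level h g" "Y \<in> level h g" using XY union(1) by auto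
    have "left_of (?\<pi> \<beta> ` subtree h Y) (?\<pi> \<beta> ` subtree h X)"
      using ro XY lt lev \<pi>parent[of _ \<beta>] unfolding reverse_ordered_def by fastforce
    moreover have "X \<in> subtree h X" "Y \<in> subtree h Y"
      using lev by (auto simp: subtree_def level_def)
    ultimately have "?\<pi> \<beta> Y < ?\<pi> \<beta> X" unfolding left_of_def by blast
    then show ?thesis using \<pi>root lev by simp
  qed
  have "connecting_product h g (?\<pi> \<beta>) \<le> connecting_product h g (?\<pi> \<gamma>)"
    if \<gamma>: "admissible h g pA slots Lg Rg \<gamma>" for \<gamma>
  proof -
    have EL: "?E \<delta> r = pA (parent r) - ?f (\<delta> r)"
      if "admissible h g pA slots Lg Rg \<delta>" "r \<in> Lg" for \<delta> r
    proof -
      have "r \<in> level h g" "\<delta> r \<in> SL" using bijL[OF that(1)] that(2) union(1)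
        by (auto simp: bij_betw_def)
      then show ?thesis using ltL[of r "\<delta> r"] by (simp add: edge_length_def \<pi>root \<pi>parent)
    qed
    \<comment> \<open>On the right the roots lie beyond the leaves. Negating both families restores
      the form \<open>a - f\<close> with \<open>f \<le> a\<close>, and antitonicity survives because
      both orders are reversed.\<close>
    have ER: "?E \<delta> r = - pA (parent r) - (- ?f (\<delta> r))"
      if "admissible h g pA slots Lg Rg \<delta>" "r \<in> Rg" for \<delta> r
    proof -
      have "r \<in> level h g" "\<delta> r \<in> SR" using bijR[OF that(1)] that(2) union(1)
        by (auto simp: bij_betw_def)
      then show ?thesis using ltR[of r "\<delta> r"] by (simp add: edge_length_def \<pi>root \<pi>parent)
    qed
    have "(\<Prod>r\<in>Lg. pA (parent r) - ?f (\<beta> r)) \<le> (\<Prod>r\<in>Lg. pA (parent r) - ?f (\<gamma> r))"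
      using ltL anti union(1)[symmetric]
      by (intro prod_diff_le_of_antitone_bij[OF fin(1) bijL[OF ad] bijL[OF \<gamma>]])
        (auto intro!: less_imp_le)
    then have L: "(\<Prod>r\<in>Lg. ?E \<beta> r) \<le> (\<Prod>r\<in>Lg. ?E \<gamma> r)"
      using EL[OF ad] EL[OF \<gamma>] by (simp cong: prod.cong)
    have "(\<Prod>r\<in>Rg. - pA (parent r) - (- ?f (\<beta> r))) \<le> (\<Prod>r\<in>Rg. - pA (parent r) - (- ?f (\<gamma> r)))"
      using ltR anti union(1)[symmetric]
      by (intro prod_diff_le_of_antitone_bij[OF fin(2) bijR[OF ad] bijR[OF \<gamma>]])
        (auto intro!: less_imp_le)
    then have R: "(\<Prod>r\<in>Rg. ?E \<beta> r) \<le> (\<Prod>r\<in>Rg. ?E \<gamma> r)"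
      using ER[OF ad] ER[OF \<gamma>] by (simp cong: prod.cong)
    have split: "connecting_product h g (?\<pi> \<delta>) = (\<Prod>r\<in>Lg. ?E \<delta> r) * (\<Prod>r\<in>Rg. ?E \<delta> r)" for \<delta>
      unfolding connecting_product_def union(1)[symmetric]
      by (rule prod.union_disjoint[OF fin union(2)])
    show ?thesis unfolding split
      \<comment> \<open>Edge lengths are absolute values, so the one-sided products are nonnegative
        and the two inequalities multiply.\<close>
      by (intro mult_mono L R prod_nonneg) (auto simp: edge_length_def)
  qed
  then show ?thesis using ad by (auto simp: is_arg_min_linorder)
qed

end
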